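(* Let $v$ be a point which is not a pole of $\wp(\cdot;g_2,g_3)$ and let $\Phi(u;v)=\frac{\sigma(v-u)}{\sigma(u)\sigma(v)}\exp(\zeta(v)u)$ be the Baker–Akhiezer function. Then in the vicinity of $u=0$ the function $f_0(u)=1/\Phi(u;v)$ is a Hurwitz series over $\mathbb{Z}[a_2,a_3,a_4]$, where $a_2=\wp(v)$, $a_3=\wp'(v)$, $a_4=\frac12g_2$; that is, $f_0(u)=\sum_{k\ge0}P_k(a_2,a_3,a_4)u^k/k!$ for polynomials $P_k$ with integer coefficients.
   Context: $\wp(u)=\wp(u;g_2,g_3)$ is the Weierstrass function ($\wp'^2=4\wp^3-g_2\wp-g_3$), $\sigma$ the Weierstrass sigma function (entire, odd, $\sigma(u)=u+O(u^5)$), $\zeta=\sigma'/\sigma$, $\wp=-\zeta'$. A Hurwitz series over a ring $A$ is a series $\sum_k\varphi_ku^k/k!$ with all $\varphi_k\in A$. *)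

theory Defs
  imports "HOL-Complex_Analysis.Complex_Analysis" "HOL-Library.Landau_Symbols"
begin

definition wzeta :: "(complex \<Rightarrow> complex) \<Rightarrow> complex \<Rightarrow> complex" where
  "wzeta sg u = deriv sg u / sg u"

definition wp :: "(complex \<Rightarrow> complex) \<Rightarrow> complex \<Rightarrow> complex" where
  "wp sg u = - deriv (wzeta sg) u"

text \<open>Characterisation of the Weierstrass sigma function for invariants g2, g3:
  entire, odd, sigma(u) = u + O(u^5), and wp = -(sigma'/sigma)' satisfies
  wp'^2 = 4 wp^3 - g2 wp - g3 (away from the zeros of sigma).
  These properties determine sigma uniquely.\<close>
definition is_weierstrass_sigma :: "complex \<Rightarrow> complex \<Rightarrow> (complex \<Rightarrow> complex) \<Rightarrow> bool" where
  "is_weierstrass_sigma g2 g3 sg \<longleftrightarrow>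
     sg holomorphic_on UNIV \<and>
     (\<forall>u. sg (-u) = - sg u) \<and>
     (\<lambda>u. sg u - u) \<in> O[at 0](\<lambda>u. u ^ 5) \<and>
     (\<forall>u. sg u \<noteq> 0 \<longrightarrow>
        (deriv (wp sg) u)\<^sup>2 = 4 * (wp sg u) ^ 3 - g2 * wp sg u - g3)"

definition baker_akhiezer :: "(complex \<Rightarrow> complex) \<Rightarrow> complex \<Rightarrow> complex \<Rightarrow> complex" where
  "baker_akhiezer sg v u = sg (v - u) / (sg u * sg v) * exp (wzeta sg v * u)"

definition in_int_poly3 :: "complex \<Rightarrow> complex \<Rightarrow> complex \<Rightarrow> complex \<Rightarrow> bool" where
  "in_int_poly3 a b c x \<longleftrightarrow>
     (\<exists>(N::nat) (P::nat \<Rightarrow> nat \<Rightarrow> nat \<Rightarrow> int).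
        x = (\<Sum>i\<le>N. \<Sum>j\<le>N. \<Sum>l\<le>N. of_int (P i j l) * a ^ i * b ^ j * c ^ l))"

text \<open>f is (near 0) a Hurwitz series sum phi_k u^k/k! with all phi_k in Z[a,b,c]:
  f is analytic at 0 and its k-th derivatives at 0 lie in Z[a,b,c].\<close>
definition hurwitz_over_Z3 :: "complex \<Rightarrow> complex \<Rightarrow> complex \<Rightarrow> (complex \<Rightarrow> complex) \<Rightarrow> bool" where
  "hurwitz_over_Z3 a b c f \<longleftrightarrow>
     f analytic_on {0} \<and> (\<forall>k. in_int_poly3 a b c ((deriv ^^ k) f 0))"

end

theory Submission
  imports Defs
begin

text \<open>
  Put \<open>f = 1 / \<Phi>\<close> and \<open>q(u) = \<wp>(v - u)\<close>. The logarithmic derivative of \<open>f\<close> is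
  \<open>L(u) = \<zeta>(u) + \<zeta>(v - u) - \<zeta>(v)\<close>, and \<open>L' = q - \<wp>\<close>. The addition theorem
  \<open>L\<^sup>2 = \<wp>(u) + \<wp>(v) + \<wp>(v - u)\<close> therefore gives the linear equation \<open>f'' = (a\<^sub>2 + 2 q) f\<close> with
  \<open>f(0) = 0\<close>, \<open>f'(0) = 1\<close>. Moreover \<open>q'' = 6 q\<^sup>2 - a\<^sub>4\<close> with \<open>q(0) = a\<^sub>2\<close>, \<open>q'(0) = - a\<^sub>3\<close>. Both
  recursions for the derivatives at \<open>0\<close> have integer coefficients.

  Periodicity is not available, so the addition theorem is proved near \<open>u = 0\<close> by Euler's
  method: with \<open>N = (\<wp>'(u) - \<wp>'(v - u)) / (2 (\<wp>(u) - \<wp>(v - u)))\<close> both \<open>L + N\<close> and then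
  \<open>L\<^sup>2 - \<wp>(u) - \<wp>(v - u)\<close> have zero derivative, and their values are read off as \<open>u \<rightarrow> 0\<close>.
\<close>

section \<open>Values of integer polynomials in three complex numbers\<close>

text \<open>Any finite set of exponent triples may serve as support here, whereas the definition
  fixes a box with one bound \<open>N\<close>. Single monomials and unions of supports then fit
  directly; padding with zero coefficients recovers the box.\<close>

lemma in_int_poly3_iff:
  "in_int_poly3 a b c x \<longleftrightarrow>
     (\<exists>I (P :: nat \<times> nat \<times> nat \<Rightarrow> int). finite I \<and>
        x = (\<Sum>(i, j, l)\<in>I. of_int (P (i, j, l)) * a ^ i * b ^ j * c ^ l))"
  (is "_ \<longleftrightarrow> ?R")
proof
  assume "in_int_poly3 a b c x"
  then obtain N P where
    x: "x = (\<Sum>i\<le>N. \<Sum>j\<le>N. \<Sum>l\<le>N. of_int (P i j l) * a ^ i * b ^ j * c ^ l)"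
    unfolding in_int_poly3_def by blast
  show ?R
    by (rule exI[of _ "{..N} \<times> {..N} \<times> {..N::nat}"], rule exI[of _ "\<lambda>(i, j, l). P i j l"])
       (simp add: x sum.cartesian_product)
next
  assume ?R
  then obtain I and P :: "nat \<times> nat \<times> nat \<Rightarrow> int" where I: "finite I" and
    x: "x = (\<Sum>(i, j, l)\<in>I. of_int (P (i, j, l)) * a ^ i * b ^ j * c ^ l)"
    by blast
  \<comment> \<open>\<open>N\<close> bounds every exponent that occurs; the inserted 0 keeps
    \<open>Max\<close> meaningful when \<open>I\<close> is empty.\<close>
  define N where "N = Max (insert 0 (fst ` I \<union> (fst \<circ> snd) ` I \<union> (snd \<circ> snd) ` I))"
  have sub: "I \<subseteq> {..N} \<times> {..N} \<times> {..N}"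
  proof
    fix t assume t: "t \<in> I"
    have "fst t \<le> N" "(fst \<circ> snd) t \<le> N" "(snd \<circ> snd) t \<le> N"
      unfolding N_def by (rule Max_ge; use I t in force)+
    then show "t \<in> {..N} \<times> {..N} \<times> {..N}"
      by (cases t) auto
  qed
  have "x = (\<Sum>(i, j, l)\<in>{..N} \<times> {..N} \<times> {..N}.
      of_int (if (i, j, l) \<in> I then P (i, j, l) else 0) * a ^ i * b ^ j * c ^ l)"
    unfolding x by (rule sum.mono_neutral_cong_left) (use sub in auto)
  then show "in_int_poly3 a b c x"
    unfolding in_int_poly3_def
    by (intro exI[of _ N] exI[of _ "\<lambda>i j l. if (i, j, l) \<in> I then P (i, j, l) else 0"])
       (simp add: sum.cartesian_product)
qed

lemma in_int_poly3_monomial: "in_int_poly3 a b c (of_int m * a ^ i * b ^ j * c ^ l)"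
  unfolding in_int_poly3_iff
  by (intro exI[of _ "{(i, j, l)}"] exI[of _ "\<lambda>_. m"]) simp

lemma in_int_poly3_add:
  assumes "in_int_poly3 a b c x" "in_int_poly3 a b c y"
  shows "in_int_poly3 a b c (x + y)"
proof -
  let ?m = "\<lambda>P (i, j, l). of_int (P (i, j, l)) * a ^ i * b ^ j * c ^ l"
  obtain I P where I: "finite I" "x = sum (?m P) I"
    using assms(1) unfolding in_int_poly3_iff by blast
  obtain J Q where J: "finite J" "y = sum (?m Q) J"
    using assms(2) unfolding in_int_poly3_iff by blast
  \<comment> \<open>Padding with zero coefficients gives both sums the common support
    \<open>I \<union> J\<close>.\<close>
  define P' where "P' = (\<lambda>t. if t \<in> I then P t else 0)"
  define Q' where "Q' = (\<lambda>t. if t \<in> J then Q t else 0)"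
  have "x = sum (?m P') (I \<union> J)" "y = sum (?m Q') (I \<union> J)"
    unfolding I(2) J(2)
    by (rule sum.mono_neutral_cong_left; use I J in \<open>auto simp: P'_def Q'_def\<close>)+
  then have "x + y = sum (?m (\<lambda>t. P' t + Q' t)) (I \<union> J)"
    by (auto simp: sum.distrib[symmetric] algebra_simps intro!: sum.cong)
  with I(1) J(1) show ?thesis
    unfolding in_int_poly3_iff by (intro exI[of _ "I \<union> J"] exI[of _ "\<lambda>t. P' t + Q' t"]) auto
qed

lemma in_int_poly3_of_int: "in_int_poly3 a b c (of_int m)"
  using in_int_poly3_monomial[of a b c m 0 0 0] by simp

lemma in_int_poly3_sum:
  "(\<And>t. t \<in> T \<Longrightarrow> in_int_poly3 a b c (g t)) \<Longrightarrow> in_int_poly3 a b c (sum g T)"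
  by (induction T rule: infinite_finite_induct)
     (auto intro: in_int_poly3_add simp: in_int_poly3_of_int[of _ _ _ 0, simplified])

text \<open>A product of two monomials is again a monomial, and the product of two finite sums
  expands into a double sum of such terms. Closure under sums then suffices, and like terms are
  never collected.\<close>

lemma in_int_poly3_mult:
  assumes "in_int_poly3 a b c x" "in_int_poly3 a b c y"
  shows "in_int_poly3 a b c (x * y)"
proof -
  let ?m = "\<lambda>P (i, j, l). of_int (P (i, j, l)) * a ^ i * b ^ j * c ^ l"
  obtain I and P :: "nat \<times> nat \<times> nat \<Rightarrow> int" where x: "x = sum (?m P) I"
    using assms(1) unfolding in_int_poly3_iff by blast
  obtain J and Q :: "nat \<times> nat \<times> nat \<Rightarrow> int" where y: "y = sum (?m Q) J"
    using assms(2) unfolding in_int_poly3_iff by blast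
  have "?m P s * ?m Q t = (case s of (i, j, l) \<Rightarrow> case t of (i', j', l') \<Rightarrow>
      of_int (P s * Q t) * a ^ (i + i') * b ^ (j + j') * c ^ (l + l'))" for s t
    by (simp add: power_add algebra_simps split: prod.split)
  then have "in_int_poly3 a b c (?m P s * ?m Q t)" for s t
    using in_int_poly3_monomial by (simp del: of_int_mult split: prod.split)
  then show ?thesis
    unfolding x y sum_product by (intro in_int_poly3_sum)
qed

lemma in_int_poly3_generators:
  "in_int_poly3 a b c a" "in_int_poly3 a b c b" "in_int_poly3 a b c c"
  using in_int_poly3_monomial[of a b c 1 1 0 0] in_int_poly3_monomial[of a b c 1 0 1 0]
    in_int_poly3_monomial[of a b c 1 0 0 1] by simp_all

lemma in_int_poly3_uminus: "in_int_poly3 a b c x \<Longrightarrow> in_int_poly3 a b c (- x)"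
  using in_int_poly3_mult[OF in_int_poly3_of_int[of a b c "-1"]] by fastforce

section \<open>Hurwitz coefficients from second-order differential equations\<close>

text \<open>The coefficient conditions hold up to order \<open>n\<close> only, so that products can be used inside
  inductions on \<open>n\<close>.\<close>

definition hurwitz_upto ::
    "complex \<Rightarrow> complex \<Rightarrow> complex \<Rightarrow> complex set \<Rightarrow> nat \<Rightarrow> (complex \<Rightarrow> complex) \<Rightarrow> bool" where
  "hurwitz_upto a b c S n f \<longleftrightarrow>
     f holomorphic_on S \<and> (\<forall>k\<le>n. in_int_poly3 a b c ((deriv ^^ k) f 0))"

lemma hurwitz_upto_const: "in_int_poly3 a b c x \<Longrightarrow> hurwitz_upto a b c S n (\<lambda>_. x)"
  using in_int_poly3_of_int[of a b c 0] by (auto simp: hurwitz_upto_def)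

lemma hurwitz_upto_add:
  assumes "open S" "0 \<in> S" "hurwitz_upto a b c S n f" "hurwitz_upto a b c S n g"
  shows "hurwitz_upto a b c S n (\<lambda>u. f u + g u)"
  using assms unfolding hurwitz_upto_def
  by (auto intro!: holomorphic_intros in_int_poly3_add simp: higher_deriv_add[of f S g])

lemma hurwitz_upto_mult:
  assumes "open S" "0 \<in> S" "hurwitz_upto a b c S n f" "hurwitz_upto a b c S n g"
  shows "hurwitz_upto a b c S n (\<lambda>u. f u * g u)"
proof -
  have "in_int_poly3 a b c (of_nat m)" for m
    using in_int_poly3_of_int[of a b c "int m"] by simp
  then show ?thesis
    using assms unfolding hurwitz_upto_def
    by (auto intro!: holomorphic_intros in_int_poly3_sum in_int_poly3_mult
        simp: higher_deriv_mult[of f S g])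
qed

text \<open>The equation identifies derivative k + 2 of \<open>f\<close> at 0 with derivative k of
  \<open>R\<close>. As \<open>R\<close> may be built from \<open>f\<close> itself, its assumption
  only passes from order n to the same order n; the induction still advances, because derivative n +
  1 of \<open>f\<close> requires \<open>R\<close> only to order n - 1.\<close>

lemma hurwitz_of_second_order_ode:
  assumes S: "open S" "0 \<in> S" and f: "f holomorphic_on S"
    and ode: "\<And>u. u \<in> S \<Longrightarrow> deriv (deriv f) u = R u"
    and init: "in_int_poly3 a b c (f 0)" "in_int_poly3 a b c (deriv f 0)"
    and R: "\<And>n. hurwitz_upto a b c S n f \<Longrightarrow> hurwitz_upto a b c S n R"
  shows "hurwitz_upto a b c S n f"
proof -
  have step: "(deriv ^^ Suc (Suc k)) f 0 = (deriv ^^ k) R 0" for k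
  proof -
    have "(deriv ^^ Suc (Suc k)) f 0 = (deriv ^^ k) (deriv (deriv f)) 0"
      by (simp add: funpow_swap1)
    also have "\<dots> = (deriv ^^ k) R 0"
      using S ode by (intro higher_deriv_cong_ev) (auto simp: eventually_nhds)
    finally show ?thesis .
  qed
  show ?thesis
  proof (induction n)
    case 0
    then show ?case using f init by (simp add: hurwitz_upto_def)
  next
    case (Suc n)
    have "in_int_poly3 a b c ((deriv ^^ Suc n) f 0)"
    proof (cases n)
      case 0
      then show ?thesis using init by simp
    next
      case (Suc m)
      have "in_int_poly3 a b c ((deriv ^^ m) R 0)"
        using R[OF Suc.IH] Suc by (simp add: hurwitz_upto_def)
      then show ?thesis
        by (simp only: Suc step)
    qed
    with Suc.IH show ?case
      by (auto simp: hurwitz_upto_def le_Suc_eq)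
  qed
qed

section \<open>Logarithmic derivatives at a zero of sigma\<close>

text \<open>The power of w - v contributes the simple pole and \<open>g\<close> the regular
  remainder. General \<open>n\<close> serves a zero of unknown order; the zero at the origin is the
  case n = 1.\<close>

lemma wzeta_at_zero:
  assumes g: "g holomorphic_on ball v e" "\<And>w. w \<in> ball v e \<Longrightarrow> g w \<noteq> 0"
    and sg: "\<And>w. w \<in> ball v e \<Longrightarrow> sg w = (w - v) ^ n * g w" and n: "n > 0"
    and w: "w \<in> ball v e - {v}"
  shows "wzeta sg w = of_nat n / (w - v) + deriv g w / g w"
proof -
  have g': "(g has_field_derivative deriv g w) (at w)"
    using g w by (intro holomorphic_derivI[of _ "ball v e"]) auto
  have "((\<lambda>w. (w - v) ^ n * g w) has_field_derivative
      of_nat n * (w - v) ^ (n - 1) * g w + (w - v) ^ n * deriv g w) (at w)"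
    by (auto intro!: derivative_eq_intros g')
  then have "(sg has_field_derivative
      of_nat n * (w - v) ^ (n - 1) * g w + (w - v) ^ n * deriv g w) (at w)"
    by (rule has_field_derivative_transform_within_open[where S = "ball v e"])
       (use w sg in auto)
  then have "deriv sg w = of_nat n * (w - v) ^ (n - 1) * g w + (w - v) ^ n * deriv g w"
    by (rule DERIV_imp_deriv)
  moreover obtain m where "n = Suc m"
    using n by (cases n) auto
  ultimately have "wzeta sg w = (of_nat n * (w - v) ^ m * g w + (w - v) ^ m * (w - v) * deriv g w) /
      ((w - v) ^ m * (w - v) * g w)"
    using w sg[of w] by (simp add: wzeta_def mult_ac)
  also have "\<dots> = of_nat n / (w - v) + deriv g w / g w"
    using w g(2)[of w] by (simp add: add_divide_distrib)
  finally show ?thesis .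
qed

lemma wp_at_zero:
  assumes g: "g holomorphic_on ball v e" "\<And>w. w \<in> ball v e \<Longrightarrow> g w \<noteq> 0"
    and sg: "\<And>w. w \<in> ball v e \<Longrightarrow> sg w = (w - v) ^ n * g w" and n: "n > 0"
    and w: "w \<in> ball v e - {v}"
  shows "wp sg w = of_nat n / (w - v)\<^sup>2 - deriv (\<lambda>w. deriv g w / g w) w"
proof -
  define k where "k = (\<lambda>w. deriv g w / g w)"
  have "k holomorphic_on ball v e"
    unfolding k_def using g by (intro holomorphic_intros) auto
  then have k': "(k has_field_derivative deriv k w) (at w)"
    using w by (intro holomorphic_derivI[of _ "ball v e"]) auto
  have "((\<lambda>w. of_nat n / (w - v) + k w) has_field_derivative
      - of_nat n / (w - v)\<^sup>2 + deriv k w) (at w)"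
    by (rule derivative_eq_intros k' refl | use w in \<open>simp add: power2_eq_square\<close>)+
  then have "(wzeta sg has_field_derivative - of_nat n / (w - v)\<^sup>2 + deriv k w) (at w)"
    by (rule has_field_derivative_transform_within_open[where S = "ball v e - {v}"])
       (use w wzeta_at_zero[where sg = sg, OF g sg n] in \<open>auto simp: k_def\<close>)
  then show ?thesis
    by (simp add: wp_def DERIV_imp_deriv k_def)
qed

text \<open>A zero of order n > 0 produces the double pole n / (w - v)^2. The contrapositive turns
  the assumption that v is not a pole of \<open>wp sg\<close> into
  \<open>sg v \<noteq> 0\<close>.\<close>

lemma is_pole_wp_at_zero:
  assumes sg: "sg holomorphic_on UNIV" "\<not> sg constant_on UNIV" and v: "sg v = 0"
  shows "is_pole (wp sg) v"
proof -
  obtain g e n where n: "0 < n" and e: "0 < e" and g: "g holomorphic_on ball v e"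
    "\<And>w. w \<in> ball v e \<Longrightarrow> g w \<noteq> 0"
    and eq: "\<And>w. w \<in> ball v e \<Longrightarrow> sg w = (w - v) ^ n * g w"
    using holomorphic_factor_zero_nonconstant[OF sg(1) open_UNIV connected_UNIV UNIV_I v sg(2)]
    by metis
  define k where "k = (\<lambda>w. deriv g w / g w)"
  have "k holomorphic_on ball v e"
    unfolding k_def using g by (intro holomorphic_intros) auto
  \<comment> \<open>The numerator is holomorphic near v and has the nonzero value n there.\<close>
  then have "is_pole (\<lambda>w. (of_nat n - (w - v)\<^sup>2 * deriv k w) / (w - v) ^ 2) v"
    using n e by (intro is_pole_basic[of _ "ball v e"] holomorphic_intros) auto
  moreover have "eventually (\<lambda>w. w \<in> ball v e - {v}) (at v)"
    using e by (intro eventually_at_in_open) auto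
  then have "eventually (\<lambda>w. (of_nat n - (w - v)\<^sup>2 * deriv k w) / (w - v) ^ 2 = wp sg w) (at v)"
  proof eventually_elim
    case (elim w)
    then show ?case
      using wp_at_zero[where sg = sg, OF g eq n, of w] by (auto simp: k_def field_simps)
  qed
  ultimately show ?thesis
    by (rule is_pole_transform) simp
qed

lemma has_field_derivative_reflect:
  assumes "(g has_field_derivative d) (at (v - u))"
  shows "((\<lambda>u. g (v - u)) has_field_derivative - d) (at (u::complex))"
proof -
  have "((\<lambda>u. v - u) has_field_derivative - 1) (at u)"
    by (auto intro!: derivative_eq_intros)
  from DERIV_chain2[OF assms this] show ?thesis
    by simp
qed

section \<open>Domain and local expansions of zeta and the Weierstrass function\<close>

locale weierstrass_sigma =
  fixes g2 g3 :: complex and sg :: "complex \<Rightarrow> complex"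
  assumes sigma: "is_weierstrass_sigma g2 g3 sg"
begin

abbreviation D :: "complex set" where "D \<equiv> {u. sg u \<noteq> 0}"

lemma holomorphic_sg: "sg holomorphic_on A"
  using sigma holomorphic_on_subset unfolding is_weierstrass_sigma_def by blast

lemma sg_0: "sg 0 = 0"
proof -
  have "sg (- 0) = - sg 0"
    using sigma unfolding is_weierstrass_sigma_def by blast
  then show ?thesis
    by simp
qed

lemma open_D: "open D"
  using holomorphic_on_imp_continuous_on[OF holomorphic_sg[of UNIV]]
  by (intro open_Collect_neq) auto

lemma holomorphic_wzeta: "wzeta sg holomorphic_on D"
proof -
  have "(\<lambda>u. deriv sg u / sg u) holomorphic_on D"
    by (intro holomorphic_intros holomorphic_sg open_D) auto
  then show ?thesis
    by (simp add: wzeta_def[abs_def])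
qed

lemma holomorphic_wp: "wp sg holomorphic_on D"
  unfolding wp_def[abs_def] by (intro holomorphic_intros holomorphic_wzeta open_D)

lemma has_field_derivative_wzeta:
  "sg u \<noteq> 0 \<Longrightarrow> (wzeta sg has_field_derivative - wp sg u) (at u)"
  using holomorphic_derivI[OF holomorphic_wzeta open_D, of u UNIV] by (simp add: wp_def)

lemma has_field_derivative_wp:
  "sg u \<noteq> 0 \<Longrightarrow> (wp sg has_field_derivative deriv (wp sg) u) (at u)"
  using holomorphic_derivI[OF holomorphic_wp open_D, of u UNIV] by simp

text \<open>The growth condition bounds (sigma(u) - u) / u^5 near 0, so Riemann's theorem on
  removable singularities extends this quotient to an entire function \<open>r\<close>.\<close>

lemma sg_expansion:
  obtains r where "r holomorphic_on UNIV" "\<And>u. sg u = u * (1 + u ^ 4 * r u)"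
proof -
  have "(\<lambda>u. sg u - u) \<in> O[at 0](\<lambda>u. u ^ 5)"
    using sigma by (simp add: is_weierstrass_sigma_def)
  then obtain C where C: "eventually (\<lambda>u. norm (sg u - u) \<le> C * norm (u ^ 5)) (at 0)"
    by (rule landau_o.bigE)
  have "eventually (\<lambda>u::complex. u \<noteq> 0) (at 0)"
    by (simp add: eventually_at_filter)
  with C have "eventually (\<lambda>u. norm ((sg u - u) / u ^ 5) \<le> C) (at 0)"
    by eventually_elim (simp add: norm_divide field_simps)
  then have "\<exists>r. r holomorphic_on UNIV \<and> (\<forall>u \<in> UNIV - {0}. r u = (sg u - u) / u ^ 5)"
    by (subst holomorphic_on_extend_bounded) (auto intro!: holomorphic_intros holomorphic_sg)
  then obtain r where r: "r holomorphic_on UNIV" "\<And>u. u \<noteq> 0 \<Longrightarrow> r u = (sg u - u) / u ^ 5"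
    by auto
  show ?thesis
  proof (rule that[OF r(1)])
    fix u
    show "sg u = u * (1 + u ^ 4 * r u)"
      using r(2)[of u] sg_0 by (cases "u = 0") (auto simp: field_simps eval_nat_numeral)
  qed
qed

lemma deriv_sg_0: "deriv sg 0 = 1"
proof -
  obtain r where r: "r holomorphic_on UNIV" and sg: "\<And>u. sg u = u * (1 + u ^ 4 * r u)"
    using sg_expansion by blast
  have "(r has_field_derivative deriv r 0) (at 0)"
    using r by (intro holomorphic_derivI[of _ UNIV]) auto
  then have "((\<lambda>u. u * (1 + u ^ 4 * r u)) has_field_derivative 1) (at 0)"
    by (auto intro!: derivative_eq_intros)
  then show ?thesis
    unfolding sg[abs_def, symmetric] by (rule DERIV_imp_deriv)
qed

text \<open>Here \<open>k\<close> is the logarithmic derivative of the factor h = 1 + u^4 r of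
  sigma, so the poles at 0 stand explicitly and \<open>k\<close> carries the regular part.\<close>

lemma expansions_at_0:
  obtains e k where "0 < e" "k holomorphic_on ball 0 e" "k 0 = 0" "deriv k 0 = 0"
    "\<And>u. u \<in> ball 0 e - {0} \<Longrightarrow> sg u \<noteq> 0 \<and> wzeta sg u = 1 / u + k u \<and>
       wp sg u = 1 / u\<^sup>2 - deriv k u \<and> deriv (wp sg) u = - 2 / u ^ 3 - deriv (deriv k) u"
proof -
  obtain r where r: "r holomorphic_on UNIV" and sg: "\<And>u. sg u = u * (1 + u ^ 4 * r u)"
    using sg_expansion by blast
  define h where "h = (\<lambda>u. 1 + u ^ 4 * r u)"
  have h: "h holomorphic_on A" for A
    unfolding h_def using holomorphic_on_subset[OF r] by (intro holomorphic_intros) auto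
  have "isCont h 0"
    using h[of UNIV] holomorphic_on_imp_continuous_on continuous_on_eq_continuous_at by blast
  moreover have "h 0 \<noteq> 0"
    by (simp add: h_def)
  ultimately obtain e where e: "0 < e" and h0: "\<And>u. u \<in> ball 0 e \<Longrightarrow> h u \<noteq> 0"
    using continuous_at_avoid[of 0 h 0] by (auto simp: dist_norm)
  define k where "k = (\<lambda>u. deriv h u / h u)"
  have k: "k holomorphic_on ball 0 e"
    unfolding k_def using h h0 by (intro holomorphic_intros) auto
  have r': "(r has_field_derivative deriv r u) (at u)" for u
    using r by (intro holomorphic_derivI[of _ UNIV]) auto
  have h': "deriv h u = u ^ 3 * (4 * r u + u * deriv r u)" for u
    unfolding h_def
    by (rule DERIV_imp_deriv)
       (auto intro!: derivative_eq_intros r' simp: algebra_simps eval_nat_numeral)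
  \<comment> \<open>This is k / u^3 with its singularity removed: the fourth power in h leaves a
    factor u^3 in h', which makes both k and k' vanish at 0.\<close>
  define \<kappa> where "\<kappa> = (\<lambda>u. (4 * r u + u * deriv r u) / h u)"
  have "\<kappa> holomorphic_on ball 0 e"
    unfolding \<kappa>_def using h h0 holomorphic_on_subset[OF r] by (intro holomorphic_intros) auto
  then have \<kappa>': "(\<kappa> has_field_derivative deriv \<kappa> 0) (at 0)"
    using e by (intro holomorphic_derivI[of _ "ball 0 e"]) auto
  have k_eq: "k = (\<lambda>u. u ^ 3 * \<kappa> u)"
    by (simp add: k_def \<kappa>_def h' fun_eq_iff)
  have k0: "k 0 = 0" "deriv k 0 = 0"
    unfolding k_eq by (simp, rule DERIV_imp_deriv) (auto intro!: derivative_eq_intros \<kappa>')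
  have fac: "\<And>w. w \<in> ball 0 e \<Longrightarrow> sg w = (w - 0) ^ 1 * h w"
    using sg by (simp add: h_def)
  have wp: "wp sg u = 1 / u\<^sup>2 - deriv k u" if "u \<in> ball 0 e - {0}" for u
    using wp_at_zero[where sg = sg, OF h h0 fac _ that] by (simp add: k_def)
  have "deriv (wp sg) u = - 2 / u ^ 3 - deriv (deriv k) u" if u: "u \<in> ball 0 e - {0}" for u
  proof (rule DERIV_imp_deriv)
    have k'': "(deriv k has_field_derivative deriv (deriv k) u) (at u)"
      using u k by (intro holomorphic_derivI[of _ "ball 0 e"] holomorphic_deriv) auto
    have "((\<lambda>u. 1 / u\<^sup>2 - deriv k u) has_field_derivative - 2 / u ^ 3 - deriv (deriv k) u) (at u)"
      by (rule derivative_eq_intros k'' refl | use u in \<open>simp add: field_simps eval_nat_numeral\<close>)+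
    then show "(wp sg has_field_derivative - 2 / u ^ 3 - deriv (deriv k) u) (at u)"
      by (rule has_field_derivative_transform_within_open[where S = "ball 0 e - {0}"])
         (use u wp in auto)
  qed
  moreover have "sg u \<noteq> 0 \<and> wzeta sg u = 1 / u + k u" if "u \<in> ball 0 e - {0}" for u
    using wzeta_at_zero[where sg = sg, OF h h0 fac _ that] that fac[of u] h0[of u]
    by (simp add: k_def)
  ultimately show ?thesis
    using wp k k0 e by (intro that[of e k]) auto
qed

lemma not_constant_sg: "\<not> sg constant_on UNIV"
proof
  assume "sg constant_on UNIV"
  then have "sg = (\<lambda>_. sg 0)"
    by (auto simp: constant_on_def)
  then have "deriv sg 0 = 0"
    by (metis deriv_const)
  then show False
    by (simp add: deriv_sg_0)
qed

text \<open>A nonconstant entire function has countably many zeros, and removing a countable set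
  leaves the plane connected. This allows the identity theorem on \<open>D\<close>.\<close>

lemma connected_D: "connected D"
proof -
  have "countable {z \<in> UNIV. sg z = 0}"
    by (rule holomorphic_countable_zeros[OF holomorphic_sg]) (auto simp: not_constant_sg)
  then have "connected (UNIV - {z. sg z = 0})"
    by (intro connected_open_diff_countable) auto
  then show ?thesis
    by (simp add: set_diff_eq)
qed

section \<open>The second-order equation of the Weierstrass function\<close>

text \<open>By the expansion at 0, u^3 times the derivative of \<open>wp sg\<close> tends to
  -2.\<close>

lemma deriv_wp_nonzero_near_0: "eventually (\<lambda>u. deriv (wp sg) u \<noteq> 0 \<and> sg u \<noteq> 0) (at 0)"
proof -
  obtain e k where e: "0 < e" and k: "k holomorphic_on ball 0 e"
    and exp: "\<And>u. u \<in> ball 0 e - {0} \<Longrightarrow> sg u \<noteq> 0 \<and>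
       deriv (wp sg) u = - 2 / u ^ 3 - deriv (deriv k) u"
    using expansions_at_0 by metis
  have "deriv (deriv k) holomorphic_on ball 0 e"
    using k by (intro holomorphic_deriv) auto
  then have "(deriv (deriv k) \<longlongrightarrow> deriv (deriv k) 0) (at 0)"
    using e by (metis centre_in_ball continuous_on_eq_continuous_at holomorphic_on_imp_continuous_on
        isContD open_ball)
  then have "((\<lambda>u. - 2 - u ^ 3 * deriv (deriv k) u) \<longlongrightarrow> - 2) (at 0)"
    by (auto intro!: tendsto_eq_intros)
  then have "eventually (\<lambda>u. - 2 - u ^ 3 * deriv (deriv k) u \<noteq> 0) (at 0)"
    by (rule tendsto_imp_eventually_ne) simp
  moreover have "eventually (\<lambda>u. u \<in> ball 0 e - {0}) (at 0)"
    using e by (intro eventually_at_in_open) auto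
  ultimately show ?thesis
  proof eventually_elim
    case (elim u)
    then have "deriv (wp sg) u * u ^ 3 = - 2 - u ^ 3 * deriv (deriv k) u"
      using exp[of u] by (simp add: left_diff_distrib)
    with elim show ?case
      using exp[of u] by auto
  qed
qed

text \<open>Differentiating the cubic equation gives the claim only where \<open>\<wp>' \<noteq> 0\<close>, in particular near the
  pole at \<open>0\<close>; the identity theorem on the connected set \<open>D\<close> carries it to every point.\<close>

lemma deriv2_wp:
  assumes "sg u \<noteq> 0"
  shows "deriv (deriv (wp sg)) u = 6 * (wp sg u)\<^sup>2 - g2 / 2"
proof -
  obtain e where e: "0 < e"
    and ne: "\<And>u. u \<in> ball 0 e - {0} \<Longrightarrow> deriv (wp sg) u \<noteq> 0 \<and> sg u \<noteq> 0"
    using deriv_wp_nonzero_near_0 unfolding eventually_at by (auto simp: dist_commute)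
  have holo: "deriv (wp sg) holomorphic_on D"
    by (intro holomorphic_deriv holomorphic_wp open_D)
  have local: "deriv (deriv (wp sg)) z = 6 * (wp sg z)\<^sup>2 - g2 / 2" if z: "z \<in> ball 0 e - {0}" for z
  proof -
    have z': "sg z \<noteq> 0" "deriv (wp sg) z \<noteq> 0"
      using ne z by auto
    have p'': "(deriv (wp sg) has_field_derivative deriv (deriv (wp sg)) z) (at z)"
      using holomorphic_derivI[OF holo open_D] z' by auto
    have "((\<lambda>u. (deriv (wp sg) u)\<^sup>2) has_field_derivative
        2 * deriv (wp sg) z * deriv (deriv (wp sg)) z) (at z)"
      by (auto intro!: derivative_eq_intros p'')
    moreover have "((\<lambda>u. 4 * wp sg u ^ 3 - g2 * wp sg u - g3) has_field_derivative
        (12 * (wp sg z)\<^sup>2 - g2) * deriv (wp sg) z) (at z)"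
      by (auto intro!: derivative_eq_intros has_field_derivative_wp z' simp: algebra_simps)
    then have "((\<lambda>u. (deriv (wp sg) u)\<^sup>2) has_field_derivative
        (12 * (wp sg z)\<^sup>2 - g2) * deriv (wp sg) z) (at z)"
      by (rule has_field_derivative_transform_within_open[OF _ open_D])
         (use z' sigma in \<open>auto simp: is_weierstrass_sigma_def\<close>)
    ultimately have "2 * deriv (wp sg) z * deriv (deriv (wp sg)) z =
        (12 * (wp sg z)\<^sup>2 - g2) * deriv (wp sg) z"
      by (rule DERIV_unique)
    then have "2 * deriv (deriv (wp sg)) z = 12 * (wp sg z)\<^sup>2 - g2"
      using z' by simp
    then show ?thesis
      by (simp add: field_simps)
  qed
  show ?thesis
  proof (rule analytic_continuation_open[of "ball 0 e - {0}" D
        "deriv (deriv (wp sg))" "\<lambda>u. 6 * (wp sg u)\<^sup>2 - g2 / 2"])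
    have "of_real (e / 2) \<in> ball (0::complex) e - {0}"
      using e by auto
    then show "ball (0::complex) e - {0} \<noteq> {}"
      by blast
    show "ball 0 e - {0} \<subseteq> D"
      using ne by auto
    show "deriv (deriv (wp sg)) holomorphic_on D"
      by (intro holomorphic_deriv holo open_D)
    show "(\<lambda>u. 6 * (wp sg u)\<^sup>2 - g2 / 2) holomorphic_on D"
      by (intro holomorphic_intros holomorphic_wp) simp
  qed (use assms local in \<open>simp_all add: open_D connected_D open_delete\<close>)
qed

lemma has_field_derivative_deriv_wp:
  assumes "sg u \<noteq> 0"
  shows "(deriv (wp sg) has_field_derivative 6 * (wp sg u)\<^sup>2 - g2 / 2) (at u)"
  using holomorphic_derivI[OF holomorphic_deriv[OF holomorphic_wp open_D] open_D, of u UNIV]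
    deriv2_wp[OF assms] assms by simp

section \<open>The addition theorem near the origin\<close>

text \<open>The second-order equation differentiates the numerator, and the sign from the reflection
  makes the derivative of the denominator 2 (P + Q). By the cubic equation (P - Q) (P + Q) is
  divisible by p - q. In the quotient rule \<open>g2\<close> then cancels, leaving 4 (p - q)^3 over
  4 (p - q)^2.\<close>

lemma euler_quotient_derivative:
  assumes u: "sg u \<noteq> 0" "sg (v - u) \<noteq> 0" "wp sg u \<noteq> wp sg (v - u)"
  shows "((\<lambda>u. (deriv (wp sg) u - deriv (wp sg) (v - u)) / (2 * (wp sg u - wp sg (v - u))))
    has_field_derivative wp sg u - wp sg (v - u)) (at u)"
proof -
  define p q P Q where "p = wp sg u" and "q = wp sg (v - u)"
    and "P = deriv (wp sg) u" and "Q = deriv (wp sg) (v - u)"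
  have ne: "p - q \<noteq> 0"
    using u by (simp add: p_def q_def)
  have "P\<^sup>2 - Q\<^sup>2 = (4 * p ^ 3 - g2 * p - g3) - (4 * q ^ 3 - g2 * q - g3)"
    using sigma u unfolding is_weierstrass_sigma_def p_def q_def P_def Q_def by simp
  also have "\<dots> = (p - q) * (4 * (p\<^sup>2 + p * q + q\<^sup>2) - g2)"
    by algebra
  finally have PQ: "(P - Q) * (P + Q) = (p - q) * (4 * (p\<^sup>2 + p * q + q\<^sup>2) - g2)"
    by (simp add: algebra_simps power2_eq_square)
  have "((6 * p\<^sup>2 - g2 / 2 + (6 * q\<^sup>2 - g2 / 2)) * (2 * (p - q)) - (P - Q) * (2 * (P + Q))) =
      (6 * p\<^sup>2 - g2 / 2 + (6 * q\<^sup>2 - g2 / 2)) * (2 * (p - q)) - 2 * ((P - Q) * (P + Q))"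
    by algebra
  also have "\<dots> = (p - q) * ((2 * (p - q)) * (2 * (p - q)))"
    unfolding PQ by (simp add: field_simps power2_eq_square)
  finally have num: "((6 * p\<^sup>2 - g2 / 2 + (6 * q\<^sup>2 - g2 / 2)) * (2 * (p - q)) -
      (P - Q) * (2 * (P + Q))) / ((2 * (p - q)) * (2 * (p - q))) = p - q"
    using ne by simp
  have "((\<lambda>u. deriv (wp sg) u - deriv (wp sg) (v - u)) has_field_derivative
      6 * p\<^sup>2 - g2 / 2 + (6 * q\<^sup>2 - g2 / 2)) (at u)"
    by (rule derivative_eq_intros has_field_derivative_deriv_wp has_field_derivative_reflect
        u refl | simp add: p_def q_def)+
  moreover have "((\<lambda>u. 2 * (wp sg u - wp sg (v - u))) has_field_derivative 2 * (P + Q)) (at u)"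
    by (rule derivative_eq_intros has_field_derivative_wp has_field_derivative_reflect
        u refl | simp add: P_def Q_def)+
  ultimately have "((\<lambda>u. (deriv (wp sg) u - deriv (wp sg) (v - u)) / (2 * (wp sg u - wp sg (v - u))))
    has_field_derivative ((6 * p\<^sup>2 - g2 / 2 + (6 * q\<^sup>2 - g2 / 2)) * (2 * (p - q)) -
      (P - Q) * (2 * (P + Q))) / ((2 * (p - q)) * (2 * (p - q)))) (at u)"
    unfolding p_def q_def P_def Q_def using u by (intro DERIV_divide) auto
  then show ?thesis
    unfolding num by (simp add: p_def q_def)
qed

text \<open>On a punctured ball, which is connected, a function with zero derivative equals its
  limit at the centre. The auxiliary functions \<open>k\<close>, \<open>M\<close>, \<open>m\<close>
  and \<open>K\<close> split off the poles at 0, so that these limits can be computed.\<close>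

lemma zeta_addition_near_0:
  assumes v: "sg v \<noteq> 0"
  obtains e where "0 < e" "\<And>u. u \<in> ball 0 e \<Longrightarrow> sg (v - u) \<noteq> 0"
    "\<And>u. u \<in> ball 0 e - {0} \<Longrightarrow> sg u \<noteq> 0 \<and>
       (wzeta sg u + wzeta sg (v - u) - wzeta sg v)\<^sup>2 = wp sg u + wp sg v + wp sg (v - u)"
proof -
  obtain e0 k where e0: "0 < e0" and k: "k holomorphic_on ball 0 e0" "k 0 = 0" "deriv k 0 = 0"
    and exp: "\<And>u. u \<in> ball 0 e0 - {0} \<Longrightarrow> sg u \<noteq> 0 \<and> wzeta sg u = 1 / u + k u \<and>
       wp sg u = 1 / u\<^sup>2 - deriv k u \<and> deriv (wp sg) u = - 2 / u ^ 3 - deriv (deriv k) u"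
    using expansions_at_0 by blast
  have lim_ball: "(g \<longlongrightarrow> g 0) (at 0)" if "g holomorphic_on ball 0 e0" for g
    using that e0 by (metis centre_in_ball continuous_on_eq_continuous_at
        holomorphic_on_imp_continuous_on isContD open_ball)
  have lim_k: "(k \<longlongrightarrow> 0) (at 0)" "(deriv k \<longlongrightarrow> 0) (at 0)"
      "(deriv (deriv k) \<longlongrightarrow> deriv (deriv k) 0) (at 0)"
    using lim_ball[of k] lim_ball[of "deriv k"] lim_ball[of "deriv (deriv k)"] k
    by (simp_all add: holomorphic_deriv)
  have lim_v: "((\<lambda>u. g (v - u)) \<longlongrightarrow> g v) (at 0)" if "(g has_field_derivative d) (at v)" for g d
    using DERIV_isCont[OF has_field_derivative_reflect[of g d v 0]] that by (auto dest: isContD)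
  note lim_wzeta = lim_v[OF has_field_derivative_wzeta[OF v]]
    and lim_wp = lim_v[OF has_field_derivative_wp[OF v]]
    and lim_wp' = lim_v[OF has_field_derivative_deriv_wp[OF v]]
  \<comment> \<open>Chosen so that the difference of \<open>wp sg u\<close> and
    \<open>wp sg (v - u)\<close> is (1 - u^2 M) / u^2. Near 0 this is nonzero, hence so is the
    denominator of \<open>N\<close>.\<close>
  define M where "M = (\<lambda>u. deriv k u + wp sg (v - u))"
  have lim_M: "(M \<longlongrightarrow> wp sg v) (at 0)"
    unfolding M_def by (auto intro!: tendsto_eq_intros lim_k lim_wp)
  have lim_den: "((\<lambda>u. 1 - u\<^sup>2 * M u) \<longlongrightarrow> 1) (at 0)"
    by (auto intro!: tendsto_eq_intros lim_M)
  then have "eventually (\<lambda>u. 1 - u\<^sup>2 * M u \<noteq> 0) (at 0)"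
    by (rule tendsto_imp_eventually_ne) simp
  moreover have "((\<lambda>u. sg (v - u)) \<longlongrightarrow> sg v) (at 0)"
    by (rule lim_v[OF holomorphic_derivI[OF holomorphic_sg open_UNIV UNIV_I]])
  then have "eventually (\<lambda>u. sg (v - u) \<noteq> 0) (at 0)"
    using v by (rule tendsto_imp_eventually_ne)
  moreover have "eventually (\<lambda>u. u \<in> ball 0 e0 - {0}) (at 0)"
    using e0 by (intro eventually_at_in_open) auto
  ultimately have "eventually (\<lambda>u. u \<in> ball 0 e0 - {0} \<and> sg (v - u) \<noteq> 0 \<and> 1 - u\<^sup>2 * M u \<noteq> 0) (at 0)"
    by eventually_elim auto
  then obtain e where e: "0 < e" and
    ball: "\<And>u. u \<in> ball 0 e - {0} \<Longrightarrow> u \<in> ball 0 e0 - {0} \<and> sg (v - u) \<noteq> 0 \<and> 1 - u\<^sup>2 * M u \<noteq> 0"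
    unfolding eventually_at by (auto simp: dist_commute)
  define U where "U = ball 0 e - {0::complex}"
  have U: "open U" "connected U"
    unfolding U_def by (auto intro!: connected_punctured_ball)
  have ev_U: "eventually (\<lambda>u. u \<in> U) (at 0)"
    unfolding U_def using e by (intro eventually_at_in_open) auto
  \<comment> \<open>\<open>h\<close> is a rewriting of \<open>g\<close> on \<open>U\<close> in which
    the poles have cancelled, so that its limit at 0 is visible.\<close>
  have const_on_U: "g u = c" if "\<And>u. u \<in> U \<Longrightarrow> (g has_field_derivative 0) (at u)"
    and "(h \<longlongrightarrow> c) (at 0)" and "\<And>u. u \<in> U \<Longrightarrow> g u = h u" and "u \<in> U" for g h u c
  proof -
    have "g constant_on U"
      by (rule has_field_derivative_0_imp_constant_on[OF that(1) U(2,1)])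
    then obtain d where d: "\<And>u. u \<in> U \<Longrightarrow> g u = d"
      by (auto simp: constant_on_def)
    have "eventually (\<lambda>u. h u = d) (at 0)"
      using ev_U by eventually_elim (use d that(3) in auto)
    then have "(h \<longlongrightarrow> d) (at 0)"
      by (rule tendsto_eventually)
    with that(2) have "c = d"
      by (intro tendsto_unique[of "at (0::complex)"]) auto
    with d that(4) show ?thesis
      by simp
  qed
  have sgU: "sg u \<noteq> 0" "sg (v - u) \<noteq> 0" and u0: "u \<noteq> 0" and den: "1 - u\<^sup>2 * M u \<noteq> 0"
    and expU: "wzeta sg u = 1 / u + k u" "wp sg u = 1 / u\<^sup>2 - deriv k u"
      "deriv (wp sg) u = - 2 / u ^ 3 - deriv (deriv k) u" if "u \<in> U" for u
    using ball[of u] exp[of u] that by (auto simp: U_def)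
  have diff: "wp sg u - wp sg (v - u) = (1 - u\<^sup>2 * M u) / u\<^sup>2" if "u \<in> U" for u
    using u0[OF that] by (simp add: expU[OF that] M_def field_simps)
  then have ne: "wp sg u \<noteq> wp sg (v - u)" if "u \<in> U" for u
    using den[OF that] u0[OF that] that by fastforce
  define L where "L = (\<lambda>u. wzeta sg u + wzeta sg (v - u) - wzeta sg v)"
  define N where "N = (\<lambda>u. (deriv (wp sg) u - deriv (wp sg) (v - u)) /
    (2 * (wp sg u - wp sg (v - u))))"
  \<comment> \<open>The regular part of \<open>L\<close> after removing 1 / u; it tends to 0 because
    k(0) = 0.\<close>
  define m where "m = (\<lambda>u. k u + wzeta sg (v - u) - wzeta sg v)"
  have L': "(L has_field_derivative wp sg (v - u) - wp sg u) (at u)" if "u \<in> U" for u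
    unfolding L_def
    by (rule derivative_eq_intros has_field_derivative_wzeta has_field_derivative_reflect
        sgU that refl | simp)+
  have N': "(N has_field_derivative wp sg u - wp sg (v - u)) (at u)" if "u \<in> U" for u
    unfolding N_def using sgU ne that by (intro euler_quotient_derivative)
  have L_m: "L u = 1 / u + m u" if "u \<in> U" for u
    by (simp add: L_def m_def expU[OF that])
  have m_lim: "(m \<longlongrightarrow> 0) (at 0)"
    unfolding m_def by (auto intro!: tendsto_eq_intros lim_k lim_wzeta)
  have "L u + N u = 0" if "u \<in> U" for u
  proof (rule const_on_U[OF _ _ _ that])
    \<comment> \<open>Chosen so that the numerator of \<open>N\<close> is (-2 - u^3 K) / u^3. Then
      \<open>N\<close> has the polar part -1 / u, which cancels that of \<open>L\<close>.\<close>
    define K where "K = (\<lambda>u. deriv (deriv k) u + deriv (wp sg) (v - u))"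
    have lim_K: "(K \<longlongrightarrow> deriv (deriv k) 0 + deriv (wp sg) v) (at 0)"
      unfolding K_def by (auto intro!: tendsto_eq_intros lim_k lim_wp')
    show "((\<lambda>u. m u + (- u\<^sup>2 * K u - 2 * u * M u) / (2 * (1 - u\<^sup>2 * M u))) \<longlongrightarrow> 0) (at 0)"
      by (auto intro!: tendsto_eq_intros lim_K lim_M m_lim)
    fix u assume u: "u \<in> U"
    show "((\<lambda>u. L u + N u) has_field_derivative 0) (at u)"
      using DERIV_add[OF L'[OF u] N'[OF u]] by simp
    have num: "deriv (wp sg) u - deriv (wp sg) (v - u) = (- 2 - u ^ 3 * K u) / u ^ 3"
      using u0[OF u] by (simp add: expU[OF u] K_def field_simps)
    have "a / u ^ 3 / (2 * (d / u\<^sup>2)) = a / (2 * u * d)" for a d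
      using u0[OF u] by (simp add: power2_eq_square power3_eq_cube)
    then have "N u = (- 2 - u ^ 3 * K u) / (2 * u * (1 - u\<^sup>2 * M u))"
      unfolding N_def diff[OF u] num by blast
    also have "\<dots> = - 1 / u + (- u\<^sup>2 * K u - 2 * u * M u) / (2 * (1 - u\<^sup>2 * M u))"
      using u0[OF u] den[OF u]
      by (simp add: divide_simps) (simp add: algebra_simps power2_eq_square power3_eq_cube)
    finally show "L u + N u = m u + (- u\<^sup>2 * K u - 2 * u * M u) / (2 * (1 - u\<^sup>2 * M u))"
      using L_m[OF u] by simp
  qed
  then have L_N: "L u = - N u" if "u \<in> U" for u
    using that by (simp add: eq_neg_iff_add_eq_0)
  have sq: "(L u)\<^sup>2 - wp sg u - wp sg (v - u) = wp sg v" if "u \<in> U" for u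
  proof (rule const_on_U[OF _ _ _ that])
    have k': "(k has_field_derivative 0) (at 0)"
      using holomorphic_derivI[OF k(1), of 0 UNIV] k(3) e0 by simp
    \<comment> \<open>The reflection makes the derivative of zeta(v - u) at 0 equal to
      +\<open>wp sg v\<close>, and k'(0) = 0. As m(0) = 0, this is the limit of m / u. The cross
      term 2 m / u of L^2 thus contributes 2 \<open>wp sg v\<close>, one half of which is cancelled
      by -\<open>wp sg (v - u)\<close>.\<close>
    have "(m has_field_derivative wp sg v) (at 0)"
      unfolding m_def
      by (rule derivative_eq_intros has_field_derivative_reflect k' refl
        | rule has_field_derivative_wzeta | simp add: v)+
    then have "((\<lambda>u. m u / u) \<longlongrightarrow> wp sg v) (at 0)"
      by (simp add: has_field_derivative_iff m_def k)
    then have "((\<lambda>u. 2 * (m u / u) + (m u)\<^sup>2 + deriv k u - wp sg (v - u)) \<longlongrightarrow>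
        2 * wp sg v + 0\<^sup>2 + 0 - wp sg v) (at 0)"
      by (intro tendsto_diff tendsto_add tendsto_mult tendsto_const tendsto_power
          m_lim lim_k lim_wp)
    then show "((\<lambda>u. 2 * (m u / u) + (m u)\<^sup>2 + deriv k u - wp sg (v - u)) \<longlongrightarrow> wp sg v) (at 0)"
      by simp
    fix u assume u: "u \<in> U"
    \<comment> \<open>This is L = -N with the denominator cleared, and its left side is exactly the
      derivative of the function to be shown constant.\<close>
    have "2 * L u * (wp sg (v - u) - wp sg u) - deriv (wp sg) u + deriv (wp sg) (v - u) = 0"
      using ne[OF u] unfolding L_N[OF u] N_def by (simp add: divide_simps) (simp add: algebra_simps)
    then show "((\<lambda>u. (L u)\<^sup>2 - wp sg u - wp sg (v - u)) has_field_derivative 0) (at u)"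
      using sgU[OF u]
      by (auto intro!: derivative_eq_intros L'[OF u] has_field_derivative_wp
          has_field_derivative_reflect simp: algebra_simps)
    show "(L u)\<^sup>2 - wp sg u - wp sg (v - u) =
        2 * (m u / u) + (m u)\<^sup>2 + deriv k u - wp sg (v - u)"
      using u0[OF u] unfolding L_m[OF u] expU(2)[OF u]
      by (simp add: field_simps power2_eq_square)
  qed
  show ?thesis
  proof (rule that[OF e])
    show "sg (v - u) \<noteq> 0" if "u \<in> ball 0 e" for u
      using that sgU(2)[of u] v by (cases "u = 0") (auto simp: U_def)
    show "sg u \<noteq> 0 \<and>
       (wzeta sg u + wzeta sg (v - u) - wzeta sg v)\<^sup>2 = wp sg u + wp sg v + wp sg (v - u)"
      if "u \<in> ball 0 e - {0}" for u
      using sq[of u] sgU(1)[of u] that by (auto simp: U_def L_def algebra_simps)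
  qed
qed

end

section \<open>Integrality for the reciprocal Baker-Akhiezer function\<close>

theorem mainTheorem11:
  fixes g2 g3 v :: complex and sg :: "complex \<Rightarrow> complex"
  assumes "is_weierstrass_sigma g2 g3 sg"
    and "\<not> is_pole (wp sg) v"
  shows "hurwitz_over_Z3 (wp sg v) (deriv (wp sg) v) (g2 / 2)
           (\<lambda>u. inverse (baker_akhiezer sg v u))"
proof -
  interpret weierstrass_sigma g2 g3 sg
    by standard fact
  have v: "sg v \<noteq> 0"
    using is_pole_wp_at_zero[OF holomorphic_sg not_constant_sg] assms(2) by blast
  obtain e where e: "0 < e" and ball: "\<And>u. u \<in> ball 0 e \<Longrightarrow> sg (v - u) \<noteq> 0" and
    add: "\<And>u. u \<in> ball 0 e - {0} \<Longrightarrow> sg u \<noteq> 0 \<and>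
       (wzeta sg u + wzeta sg (v - u) - wzeta sg v)\<^sup>2 = wp sg u + wp sg v + wp sg (v - u)"
    using zeta_addition_near_0[OF v] by blast
  define B where "B = ball (0::complex) e"
  have B: "open B" "0 \<in> B" "connected B" "of_real (e / 2) \<in> B - {0}"
    using e by (auto simp: B_def)
  define q where "q = (\<lambda>u. wp sg (v - u))"
  define f where "f = (\<lambda>u. inverse (baker_akhiezer sg v u))"
  define Z where "Z = wzeta sg v"
  \<comment> \<open>This also holds at u = 0: division by zero and the inverse of zero are 0, so
    both sides vanish. Thus \<open>f\<close> already has the right value at the removable
    singularity.\<close>
  have f_eq: "f = (\<lambda>u. sg v * exp (- Z * u) * sg u / sg (v - u))"
    by (simp add: f_def baker_akhiezer_def Z_def exp_minus field_simps fun_eq_iff)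
  have sg': "(sg has_field_derivative deriv sg u) (at u)" for u
    by (rule holomorphic_derivI[OF holomorphic_sg open_UNIV UNIV_I])
  have f': "(f has_field_derivative sg v * exp (- Z * u) *
      (deriv sg u / sg (v - u) + sg u * deriv sg (v - u) / (sg (v - u))\<^sup>2 - Z * sg u / sg (v - u)))
      (at u)" if "u \<in> B" for u
    unfolding f_eq using ball[of u] that
    by (auto intro!: derivative_eq_intros sg' has_field_derivative_reflect
        simp: B_def field_simps power2_eq_square)
  have f_holo: "f holomorphic_on B"
    using f' B(1) holomorphic_on_open by blast
  define L where "L = (\<lambda>u. wzeta sg u + wzeta sg (v - u) - Z)"
  have f_L: "(f has_field_derivative f u * L u) (at u)" if "u \<in> B - {0}" for u
  proof -
    have "sg u \<noteq> 0" "sg (v - u) \<noteq> 0"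
      using ball[of u] add[of u] that by (auto simp: B_def)
    then have "sg v * exp (- Z * u) *
      (deriv sg u / sg (v - u) + sg u * deriv sg (v - u) / (sg (v - u))\<^sup>2 - Z * sg u / sg (v - u)) =
      f u * L u"
      by (simp add: f_eq L_def wzeta_def field_simps power2_eq_square)
    then show ?thesis
      using f'[of u] that by simp
  qed
  have f_deriv2: "deriv (deriv f) u = (wp sg v + 2 * q u) * f u" if u: "u \<in> B - {0}" for u
  proof (rule DERIV_imp_deriv)
    have ne: "sg u \<noteq> 0" "sg (v - u) \<noteq> 0"
      using ball[of u] add[of u] u by (auto simp: B_def)
    have L': "(L has_field_derivative wp sg (v - u) - wp sg u) (at u)"
      unfolding L_def
      by (rule derivative_eq_intros has_field_derivative_wzeta has_field_derivative_reflect
          ne refl | simp)+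
    have "((\<lambda>u. f u * L u) has_field_derivative
        f u * L u * L u + (wp sg (v - u) - wp sg u) * f u) (at u)"
      by (rule DERIV_mult[OF f_L[OF u] L'])
    moreover have "(L u)\<^sup>2 = wp sg u + wp sg v + wp sg (v - u)"
      using add[of u] u by (auto simp: B_def L_def Z_def)
    then have "f u * L u * L u + (wp sg (v - u) - wp sg u) * f u = (wp sg v + 2 * q u) * f u"
      unfolding q_def by (simp add: power2_eq_square mult.assoc) (simp add: algebra_simps)
    ultimately have "((\<lambda>u. f u * L u) has_field_derivative (wp sg v + 2 * q u) * f u) (at u)"
      by simp
    then show "(deriv f has_field_derivative (wp sg v + 2 * q u) * f u) (at u)"
      by (rule has_field_derivative_transform_within_open[where S = "B - {0}"])
         (use u B f_L DERIV_imp_deriv in \<open>auto simp: DERIV_imp_deriv[OF f_L]\<close>)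
  qed
  have q': "(q has_field_derivative - deriv (wp sg) (v - u)) (at u)" if "u \<in> B" for u
    unfolding q_def using ball[of u] that
    by (intro has_field_derivative_reflect has_field_derivative_wp) (auto simp: B_def)
  then have q_holo: "q holomorphic_on B"
    using B(1) holomorphic_on_open by blast
  \<comment> \<open>\<open>L\<close> has a pole at 0, so the computation above omits the very point
    of expansion. Both sides are holomorphic on \<open>B\<close>, and the identity theorem supplies
    it.\<close>
  have f_ode: "deriv (deriv f) u = (wp sg v + 2 * q u) * f u" if "u \<in> B" for u
    by (rule analytic_continuation_open[of "B - {0}" B "deriv (deriv f)"])
       (use B f_deriv2 that in \<open>auto intro!: holomorphic_intros f_holo q_holo\<close>)
  \<comment> \<open>The right side is spelled with products, a sum and a negated constant to match
    the closure rules of \<open>hurwitz_upto\<close>.\<close>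
  have q_ode: "deriv (deriv q) u = 6 * (q u * q u) + - (g2 / 2)" if u: "u \<in> B" for u
  proof (rule DERIV_imp_deriv)
    have "((\<lambda>u. - deriv (wp sg) (v - u)) has_field_derivative 6 * (q u * q u) + - (g2 / 2)) (at u)"
      unfolding q_def using ball[of u] u
      by (auto intro!: derivative_eq_intros has_field_derivative_reflect
          has_field_derivative_deriv_wp simp: B_def power2_eq_square)
    then show "(deriv q has_field_derivative 6 * (q u * q u) + - (g2 / 2)) (at u)"
      by (rule has_field_derivative_transform_within_open[OF _ B(1) u])
         (simp add: DERIV_imp_deriv[OF q'])
  qed
  let ?I = "in_int_poly3 (wp sg v) (deriv (wp sg) v) (g2 / 2)"
  let ?H = "hurwitz_upto (wp sg v) (deriv (wp sg) v) (g2 / 2) B"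
  have numeral: "?I (numeral w)" for w
    using in_int_poly3_of_int[of _ _ _ "numeral w"] by simp
  note H_intros = hurwitz_upto_const hurwitz_upto_add[OF B(1,2)] hurwitz_upto_mult[OF B(1,2)]
    in_int_poly3_uminus in_int_poly3_generators numeral
  have q_H: "?H n q" for n
  proof (rule hurwitz_of_second_order_ode[OF B(1,2) q_holo q_ode])
    show "?I (q 0)"
      by (simp add: q_def in_int_poly3_generators)
    show "?I (deriv q 0)"
      using DERIV_imp_deriv[OF q'[OF B(2)]] by (simp add: in_int_poly3_uminus in_int_poly3_generators)
  qed (assumption | rule H_intros)+
  \<comment> \<open>\<open>q\<close> is already settled at every order, so the coefficient of the
    linear equation is available at whatever order \<open>f\<close> has reached.\<close>
  have f_H: "?H n f" for n
  proof (rule hurwitz_of_second_order_ode[OF B(1,2) f_holo f_ode])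
    show "?I (f 0)"
      using in_int_poly3_of_int[of _ _ _ 0] by (simp add: f_eq sg_0)
    \<comment> \<open>At u = 0 only the term with sigma'(0) = 1 survives, since sigma(0) =
      0.\<close>
    have "deriv f 0 = 1"
      using DERIV_imp_deriv[OF f'[OF B(2)]] v by (simp add: sg_0 deriv_sg_0)
    then show "?I (deriv f 0)"
      using in_int_poly3_of_int[of _ _ _ 1] by simp
  qed (assumption | rule H_intros q_H)+
  have "f analytic_on {0}"
    using f_holo B by (auto simp: analytic_on_open analytic_at)
  moreover have "?I ((deriv ^^ k) f 0)" for k
    using f_H[of k] by (simp add: hurwitz_upto_def)
  ultimately show ?thesis
    unfolding hurwitz_over_Z3_def f_def by blast
qed

end
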